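(* Let $n\in\mathbb N$ and let $\varPhi=\{\varphi_m\}_{m=1}^\infty\subset\mathcal A$ be a family satisfying: for each $m\in\mathbb N$ and each $A>0$ there exists a constant $C_{m,A}>0$ such that $\varphi_m(x)+A\ln(1+\Vert x\Vert)\le\varphi_{m+1}(x)+C_{m,A}$ for all $x\in\mathbb R^n$. Then for each $f\in E(\varPhi)$ its restriction $f_{|\mathbb R^n}$ to $\mathbb R^n$ belongs to $\mathcal E(\Psi^* )$.
   Context: Notation: $\mathbb N=\{1,2,\dots\}$, $\mathbb Z_+=\{0,1,2,\dots\}$; $\Vert\cdot\Vert$ is the Euclidean norm on $\mathbb R^n$ or $\mathbb C^n$; $H(\mathbb C^n)$ is the space of entire functions on $\mathbb C^n$; $\langle u,v\rangle=u_1v_1+\cdots+u_nv_n$. For $\alpha\in\mathbb Z_+^n$: $|\alpha|=\alpha_1+\cdots+\alpha_n$, $\alpha!=\alpha_1!\cdots\alpha_n!$, $D^\alpha=\partial^{|\alpha|}/\partial x_1^{\alpha_1}\cdots\partial x_n^{\alpha_n}$. $\mathcal A$ is the set of all real-valued $g\in C(\mathbb R^n)$ such that: (1) $g(x)=g(|x_1|,\dots,|x_n|)$ for all $x=(x_1,\dots,x_n)\in\mathbb R^n$; (2) the restriction of $g$ to $[0,\infty)^n$ is nondecreasing in each variable; (3) $\lim_{x\to\infty}g(x)/\Vert x\Vert=+\infty$. The space $E(\varPhi)$: for $\nu\in\mathbb N$, $k\in\mathbb Z_+$ let $$E_k(\varphi_\nu)=\Big\{f\in H(\mathbb C^n):\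 p_{\nu,k}(f)=\sup_{z\in\mathbb C^n}\frac{|f(z)|(1+\Vert z\Vert)^k}{e^{\varphi_\nu(|\mathrm{Im}\,z_1|,\dots,|\mathrm{Im}\,z_n|)}}<\infty\Big\},$$ $E(\varphi_\nu)=\bigcap_{k=0}^\infty E_k(\varphi_\nu)$, $E(\varPhi)=\bigcup_{\nu=1}^\infty E(\varphi_\nu)$. The Young–Fenchel conjugate of $g:\mathbb R^n\to[-\infty,+\infty]$ is $g^*(x)=\sup_{y\in\mathbb R^n}(\langle x,y\rangle-g(y))$, $x\in\mathbb R^n$. Put $\psi_\nu(x)=\varphi_\nu(e^{x_1},\dots,e^{x_n})$ for $x\in\mathbb R^n$, and $\Psi^*=\{\psi_\nu^*\}_{\nu=1}^\infty$. The space $\mathcal E(\Psi^* )$: for $\nu\in\mathbb N$, $m\in\mathbb Z_+$ let $$\mathcal E_m(\psi_\nu^* )=\Big\{f\in C^\infty(\mathbb R^n):\ \sup_{x\in\mathbb R^n,\ \alpha\in\mathbb Z_+^n}\frac{(1+\Vert x\Vert)^m|(D^\alpha f)(x)|}{\alpha!\,e^{-\psi_\nu^*(\alpha)}}<\infty\Big\},$$ $\mathcal E(\psi_\nu^* )=\bigcap_{m=0}^\infty\mathcal E_m(\psi_\nu^* )$, $\mathcal E(\Psi^* )=\bigcup_{\nu=1}^\infty\mathcal E(\psi_\nu^* )$. Functions are complex-valued. *)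

theory Defs
  imports "HOL-Analysis.Analysis"
begin

text \<open>
  Euclidean space is \<open>real ^ 'n\<close>, complex n-space is \<open>complex ^ 'n\<close>; on both, \<open>norm\<close> is the
  Euclidean norm. Multi-indices have type \<open>nat ^ 'n\<close>. Sequences of weights have type
  \<open>nat \<Rightarrow> _\<close>, and only their entries with index \<open>\<ge> 1\<close> matter.
\<close>

definition class_A :: "(real ^ 'n \<Rightarrow> real) set" where
  "class_A = {g.
     continuous_on UNIV g \<and>
     (\<forall>x. g x = g (\<chi> i. \<bar>x $ i\<bar>)) \<and>
     (\<forall>x i t. (\<forall>j. 0 \<le> x $ j) \<and> x $ i \<le> t \<longrightarrow> g x \<le> g (\<chi> j. if j = i then t else x $ j)) \<and>
     filterlim (\<lambda>x. g x / norm x) at_top at_infinity}"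

text \<open>Differentiability with a derivative that is linear over the complex numbers, at every point.\<close>

definition entire :: "(complex ^ 'n \<Rightarrow> complex) \<Rightarrow> bool" where
  "entire f \<longleftrightarrow>
     (\<forall>z. \<exists>L. (f has_derivative L) (at z) \<and> (\<forall>c v. L (c *s v) = c * L v))"

definition p_norm :: "(real ^ 'n \<Rightarrow> real) \<Rightarrow> nat \<Rightarrow> (complex ^ 'n \<Rightarrow> complex) \<Rightarrow> ereal" where
  "p_norm \<phi> k f =
     (SUP z. ereal (norm (f z) * (1 + norm z) ^ k / exp (\<phi> (\<chi> i. \<bar>Im (z $ i)\<bar>))))"

definition E_level :: "nat \<Rightarrow> (real ^ 'n \<Rightarrow> real) \<Rightarrow> (complex ^ 'n \<Rightarrow> complex) set" where
  "E_level k \<phi> = {f. entire f \<and> p_norm \<phi> k f < \<infinity>}"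

definition E_weight :: "(real ^ 'n \<Rightarrow> real) \<Rightarrow> (complex ^ 'n \<Rightarrow> complex) set" where
  "E_weight \<phi> = (\<Inter>k. E_level k \<phi>)"

definition E_space :: "(nat \<Rightarrow> real ^ 'n \<Rightarrow> real) \<Rightarrow> (complex ^ 'n \<Rightarrow> complex) set" where
  "E_space \<Phi> = (\<Union>\<nu>\<in>{1..}. E_weight (\<Phi> \<nu>))"

definition young_fenchel :: "(real ^ 'n \<Rightarrow> ereal) \<Rightarrow> real ^ 'n \<Rightarrow> ereal" where
  "young_fenchel g x = (SUP y. ereal (x \<bullet> y) - g y)"

definition exp_subst :: "(real ^ 'n \<Rightarrow> real) \<Rightarrow> real ^ 'n \<Rightarrow> real" where
  "exp_subst \<phi> x = \<phi> (\<chi> i. exp (x $ i))"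

definition psi_star :: "(real ^ 'n \<Rightarrow> real) \<Rightarrow> real ^ 'n \<Rightarrow> ereal" where
  "psi_star \<phi> = young_fenchel (\<lambda>x. ereal (exp_subst \<phi> x))"

definition partial :: "'n \<Rightarrow> (real ^ 'n \<Rightarrow> complex) \<Rightarrow> real ^ 'n \<Rightarrow> complex" where
  "partial i f x = vector_derivative (\<lambda>t. f (x + t *\<^sub>R axis i 1)) (at 0)"

definition has_partial_at :: "'n \<Rightarrow> (real ^ 'n \<Rightarrow> complex) \<Rightarrow> real ^ 'n \<Rightarrow> bool" where
  "has_partial_at i f x \<longleftrightarrow> (\<lambda>t. f (x + t *\<^sub>R axis i 1)) differentiable (at 0)"

definition partials :: "'n list \<Rightarrow> (real ^ 'n \<Rightarrow> complex) \<Rightarrow> real ^ 'n \<Rightarrow> complex" where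
  "partials is f = foldr partial is f"

definition smooth :: "(real ^ 'n \<Rightarrow> complex) \<Rightarrow> bool" where
  "smooth f \<longleftrightarrow>
     (\<forall>is. continuous_on UNIV (partials is f) \<and> (\<forall>i x. has_partial_at i (partials is f) x))"

text \<open>
  The index type carries no order, so the order in which the partial derivatives are taken is
  chosen arbitrarily; for smooth functions it is irrelevant by Schwarz' theorem.
\<close>

definition multi_deriv :: "nat ^ 'n \<Rightarrow> (real ^ 'n \<Rightarrow> complex) \<Rightarrow> real ^ 'n \<Rightarrow> complex" where
  "multi_deriv \<alpha> f = partials (SOME is. \<forall>i. count_list is i = \<alpha> $ i) f"

definition multi_fact :: "nat ^ 'n \<Rightarrow> real" where
  "multi_fact \<alpha> = (\<Prod>i\<in>UNIV. fact (\<alpha> $ i))"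

definition multi_real :: "nat ^ 'n \<Rightarrow> real ^ 'n" where
  "multi_real \<alpha> = (\<chi> i. real (\<alpha> $ i))"

text \<open>
  In the next definition \<open>h\<close> has to be finite at multi-indices, since \<open>real_of_ereal\<close> maps infinite
  values to 0. For \<open>h = psi_star \<phi>\<close> with \<open>\<phi> \<in> class_A\<close> this is \<open>psi_star_multi_finite\<close> below.
\<close>

definition smooth_norm :: "(real ^ 'n \<Rightarrow> ereal) \<Rightarrow> nat \<Rightarrow> (real ^ 'n \<Rightarrow> complex) \<Rightarrow> ereal" where
  "smooth_norm h m f =
     (SUP (x, \<alpha>). ereal ((1 + norm x) ^ m * norm (multi_deriv \<alpha> f x) /
        (multi_fact \<alpha> * exp (- real_of_ereal (h (multi_real \<alpha>))))))"

definition smooth_level :: "nat \<Rightarrow> (real ^ 'n \<Rightarrow> ereal) \<Rightarrow> (real ^ 'n \<Rightarrow> complex) set" where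
  "smooth_level m h = {f. smooth f \<and> smooth_norm h m f < \<infinity>}"

definition smooth_weight :: "(real ^ 'n \<Rightarrow> ereal) \<Rightarrow> (real ^ 'n \<Rightarrow> complex) set" where
  "smooth_weight h = (\<Inter>m. smooth_level m h)"

definition smooth_space :: "(nat \<Rightarrow> real ^ 'n \<Rightarrow> ereal) \<Rightarrow> (real ^ 'n \<Rightarrow> complex) set" where
  "smooth_space H = (\<Union>\<nu>\<in>{1..}. smooth_weight (H \<nu>))"

definition real_restriction :: "(complex ^ 'n \<Rightarrow> complex) \<Rightarrow> real ^ 'n \<Rightarrow> complex" where
  "real_restriction f x = f (\<chi> i. complex_of_real (x $ i))"

lemma psi_star_multi_finite:
  fixes \<phi> :: "real ^ 'n \<Rightarrow> real"
  assumes "\<phi> \<in> class_A"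
  shows "\<bar>psi_star \<phi> (multi_real \<alpha>)\<bar> \<noteq> \<infinity>"
proof -
  define s where "s = (\<Sum>i\<in>UNIV. real (\<alpha> $ i))"
  have s0: "s \<ge> 0" by (simp add: s_def sum_nonneg)
  have cont: "continuous_on UNIV \<phi>"
    and lim: "filterlim (\<lambda>x. \<phi> x / norm x) at_top at_infinity"
    using assms by (auto simp: class_A_def)
  from lim have "eventually (\<lambda>x. \<phi> x / norm x \<ge> s) at_infinity"
    by (simp add: filterlim_at_top)
  then obtain R where R: "\<And>x. norm x \<ge> R \<Longrightarrow> \<phi> x / norm x \<ge> s"
    by (auto simp: eventually_at_infinity)
  define R' where "R' = max R 1"
  have "compact (\<phi> ` cball 0 R')"
    by (intro compact_continuous_image continuous_on_subset[OF cont]) auto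
  then have "bounded (\<phi> ` cball 0 R')" by (rule compact_imp_bounded)
  then obtain B where B: "\<And>x. norm x \<le> R' \<Longrightarrow> \<bar>\<phi> x\<bar> \<le> B"
    unfolding bounded_iff by fastforce
  have "\<bar>\<phi> 0\<bar> \<le> B" by (rule B) (simp add: R'_def)
  then have B0: "B \<ge> 0" by linarith
  have low: "s * norm x \<le> \<phi> x + (s * R' + B)" for x
  proof (cases "norm x \<le> R'")
    case True
    then have "s * norm x \<le> s * R'" using s0 by (intro mult_left_mono)
    then show ?thesis using B[OF True] by linarith
  next
    case False
    then have "norm x \<ge> R" "norm x > 0" by (auto simp: R'_def)
    then have "s * norm x \<le> \<phi> x" using R[of x] by (simp add: pos_le_divide_eq)
    moreover have "s * R' \<ge> 0" using s0 by (simp add: R'_def)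
    ultimately show ?thesis using B0 by linarith
  qed
  have bound: "multi_real \<alpha> \<bullet> y - exp_subst \<phi> y \<le> s * R' + B" for y
  proof -
    let ?e = "\<chi> i. exp (y $ i)"
    have "multi_real \<alpha> \<bullet> y = (\<Sum>i\<in>UNIV. real (\<alpha> $ i) * y $ i)"
      by (simp add: inner_vec_def multi_real_def)
    also have "\<dots> \<le> (\<Sum>i\<in>UNIV. real (\<alpha> $ i) * norm ?e)"
    proof (intro sum_mono mult_left_mono)
      fix i
      have "y $ i \<le> exp (y $ i)" using exp_ge_add_one_self[of "y $ i"] by linarith
      also have "\<dots> \<le> norm ?e" using component_le_norm_cart[of ?e i] by simp
      finally show "y $ i \<le> norm ?e" .
    qed auto
    also have "\<dots> = s * norm ?e" by (simp add: s_def sum_distrib_right)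
    finally show ?thesis using low[of ?e] by (simp add: exp_subst_def)
  qed
  have "psi_star \<phi> (multi_real \<alpha>) \<le> ereal (s * R' + B)"
    unfolding psi_star_def young_fenchel_def using bound by (intro SUP_least) simp
  moreover have "ereal (multi_real \<alpha> \<bullet> 0 - exp_subst \<phi> 0) \<le> psi_star \<phi> (multi_real \<alpha>)"
    unfolding psi_star_def young_fenchel_def by (rule SUP_upper2[of 0]) auto
  ultimately show ?thesis by auto
qed

end

theory Submission
  imports Defs "HOL-Complex_Analysis.Cauchy_Integral_Formula" "HOL-Library.Multiset"
begin

text \<open>
  Cauchy's estimate on the polydisc with centre \<open>x\<close> and radii \<open>R = (exp (y $ i))\<^sub>i\<close> gives
  \<open>\<bar>D\<^sup>\<alpha> f(x)\<bar> / \<alpha>! \<le> exp (- \<langle>\<alpha>, y\<rangle>) sup \<bar>f\<bar>\<close>. There \<open>f(z)\<close> is controlled by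
  \<open>exp (\<phi> \<nu> R) (1 + \<parallel>z\<parallel>)^(-m)\<close>, since \<open>\<phi> \<nu>\<close> is monotone, and
  \<open>1 + \<parallel>x\<parallel> \<le> (1 + \<parallel>z\<parallel>)(1 + \<parallel>R\<parallel>)\<close>. The factor \<open>(1 + \<parallel>R\<parallel>)^m\<close> is absorbed by passing
  from \<open>\<phi> \<nu>\<close> to \<open>\<phi> (\<nu> + 1)\<close>, and minimizing over \<open>y\<close> produces the Young-Fenchel conjugate.
\<close>

section \<open>Functions holomorphic in each variable\<close>

text \<open>Working substitute for \<open>entire\<close>: joint continuity serves integrals with
  parameters, holomorphy of the slices serves the one-variable theory, and both properties pass to
  partial derivatives.\<close>

definition sep_holomorphic :: "(complex ^ 'n \<Rightarrow> complex) \<Rightarrow> bool" where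
  "sep_holomorphic f \<longleftrightarrow>
     continuous_on UNIV f \<and> (\<forall>i z. (\<lambda>w. f (z + axis i w)) holomorphic_on UNIV)"

definition cpartial :: "'n \<Rightarrow> (complex ^ 'n \<Rightarrow> complex) \<Rightarrow> complex ^ 'n \<Rightarrow> complex" where
  "cpartial i f z = deriv (\<lambda>w. f (z + axis i w)) 0"

definition cpartials :: "'n list \<Rightarrow> (complex ^ 'n \<Rightarrow> complex) \<Rightarrow> complex ^ 'n \<Rightarrow> complex" where
  "cpartials is f = foldr cpartial is f"

lemma cpartials_simps [simp]:
  "cpartials [] f = f"
  "cpartials (i # is) f = cpartial i (cpartials is f)"
  by (simp_all add: cpartials_def)

lemma axis_zero [simp]: "axis i (0 :: 'a::zero) = 0"
  by (simp add: vec_eq_iff axis_def)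

lemma axis_add: "axis i (a + b) = axis i a + (axis i b :: 'a::monoid_add ^ 'n)"
  by (simp add: vec_eq_iff axis_def)

lemma continuous_on_axis [continuous_intros]:
  "continuous_on S g \<Longrightarrow> continuous_on S (\<lambda>x. axis i (g x) :: 'a::real_normed_vector ^ 'n)"
  unfolding axis_def
  by (rule continuous_on_vec_lambda, rename_tac j, case_tac "j = i") simp_all

text \<open>By the chain rule a slice has derivative \<open>h \<mapsto> L (axis i h)\<close>;
  complex linearity turns this into multiplication by the number
  \<open>L (axis i 1)\<close>.\<close>

lemma entire_imp_sep_holomorphic:
  fixes f :: "complex ^ 'n \<Rightarrow> complex"
  assumes "entire f"
  shows "sep_holomorphic f"
  unfolding sep_holomorphic_def
proof (intro conjI allI)
  show "continuous_on UNIV f"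
    using assms unfolding entire_def
    by (metis continuous_at_imp_continuous_on has_derivative_continuous)
next
  fix i z
  have "\<exists>d. ((\<lambda>w. f (z + axis i w)) has_field_derivative d) (at w)" for w
  proof -
    obtain L where L: "(f has_derivative L) (at (z + axis i w))"
      and Lc: "\<And>c v. L (c *s v) = c * L v"
      using assms unfolding entire_def by blast
    have "bounded_linear (\<lambda>h::complex. axis i h :: complex ^ 'n)"
    proof (rule linear_conv_bounded_linear[THEN iffD1], rule linearI)
      show "axis i (a + b) = axis i a + axis i b" for a b :: complex by (rule axis_add)
      show "axis i (r *\<^sub>R b) = r *\<^sub>R axis i b" for r and b :: complex
        by (simp add: vec_eq_iff axis_def)
    qed
    then have "((\<lambda>w::complex. z + axis i w) has_derivative (\<lambda>h. axis i h)) (at w)"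
      using has_derivative_add[OF has_derivative_const bounded_linear_imp_has_derivative] by fastforce
    then have "((\<lambda>w. f (z + axis i w)) has_derivative (\<lambda>h. L (axis i h))) (at w)"
      using diff_chain_at[of "\<lambda>w. z + axis i w" _ w f L] L by (simp add: o_def)
    moreover have "(\<lambda>h. L (axis i h)) = (*) (L (axis i 1))"
    proof
      fix h
      have "axis i h = h *s axis i (1::complex)" by (simp add: vec_eq_iff axis_def)
      then show "L (axis i h) = L (axis i 1) * h" by (simp add: Lc)
    qed
    ultimately show ?thesis by (auto simp: has_field_derivative_def)
  qed
  then show "(\<lambda>w. f (z + axis i w)) holomorphic_on UNIV"
    by (simp add: holomorphic_on_open field_differentiable_def)
qed

text \<open>\<open>cpartial\<close> differentiates a slice at 0 only; a translation of the base
  point along the slice reaches every \<open>w\<close>.\<close>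

lemma has_field_derivative_cpartial:
  assumes "sep_holomorphic f"
  shows "((\<lambda>w. f (z + axis i w)) has_field_derivative cpartial i f (z + axis i w)) (at w)"
proof -
  have "(\<lambda>h. f (z + axis i w + axis i h)) holomorphic_on UNIV"
    using assms by (simp add: sep_holomorphic_def)
  then have "((\<lambda>h. f (z + axis i w + axis i h)) has_field_derivative cpartial i f (z + axis i w)) (at 0)"
    unfolding cpartial_def by (metis holomorphic_derivI open_UNIV UNIV_I)
  then have "((\<lambda>h. f (z + axis i (w + h))) has_field_derivative cpartial i f (z + axis i w)) (at 0)"
    by (simp add: axis_add add.assoc)
  then show ?thesis
    using DERIV_shift[of "\<lambda>v. f (z + axis i v)" _ 0 w] by (simp add: add.commute)
qed

section \<open>Cauchy's integral formula for first partial derivatives\<close>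

definition unit_rot :: "real \<Rightarrow> complex" where
  "unit_rot t = exp (2 * of_real pi * \<i> * of_real t)"

lemma continuous_on_unit_rot [continuous_intros]:
  "continuous_on S g \<Longrightarrow> continuous_on S (\<lambda>x. unit_rot (g x))"
  unfolding unit_rot_def by (intro continuous_intros)

lemma unit_rot_nonzero [simp]: "unit_rot t \<noteq> 0"
  by (simp add: unit_rot_def)

text \<open>Cauchy's formula for the first derivative on the unit circle, parametrized by
  \<open>unit_rot\<close>. The velocity \<open>2 * pi * \<i> * unit_rot t\<close> cancels the
  constant and one of the two powers in the denominator.\<close>

lemma cpartial_eq_integral:
  assumes "sep_holomorphic f"
  shows "cpartial i f z = integral (cbox 0 1) (\<lambda>t. f (z + axis i (unit_rot t)) / unit_rot t)"
proof -
  let ?g = "\<lambda>w. f (z + axis i w)"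
  have hol: "?g holomorphic_on UNIV" using assms by (simp add: sep_holomorphic_def)
  have "((\<lambda>u. ?g u / (u - 0) ^ Suc 1) has_contour_integral
      (2 * pi * \<i>) / fact 1 * (deriv ^^ 1) ?g 0) (circlepath 0 1)"
    by (rule Cauchy_has_contour_integral_higher_derivative_circlepath)
       (auto intro: holomorphic_on_subset[OF hol] holomorphic_on_imp_continuous_on)
  then have *: "((\<lambda>t. ?g (circlepath 0 1 t) / circlepath 0 1 t ^ 2 *
        vector_derivative (circlepath 0 1) (at t within {0..1}))
      has_integral 2 * pi * \<i> * cpartial i f z) {0..1}"
    by (simp add: has_contour_integral_def cpartial_def power2_eq_square)
  have "((\<lambda>t. ?g (unit_rot t) / unit_rot t ^ 2 * (2 * pi * \<i> * unit_rot t))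
      has_integral 2 * pi * \<i> * cpartial i f z) {0..1}"
  proof (rule has_integral_eq[OF _ *])
    fix t :: real
    assume "t \<in> {0..1}"
    then have "vector_derivative (circlepath 0 1) (at t within {0..1}) = 2 * pi * \<i> * unit_rot t"
      by (simp add: vector_derivative_circlepath01 unit_rot_def)
    moreover have "circlepath 0 1 t = unit_rot t" by (simp add: circlepath unit_rot_def)
    ultimately show "?g (circlepath 0 1 t) / circlepath 0 1 t ^ 2 *
        vector_derivative (circlepath 0 1) (at t within {0..1}) =
        ?g (unit_rot t) / unit_rot t ^ 2 * (2 * pi * \<i> * unit_rot t)" by simp
  qed
  then have "((\<lambda>t. (?g (unit_rot t) / unit_rot t ^ 2 * (2 * pi * \<i> * unit_rot t)) / (2 * pi * \<i>))
      has_integral 2 * pi * \<i> * cpartial i f z / (2 * pi * \<i>)) {0..1}"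
    by (rule has_integral_divide)
  then have "((\<lambda>t. ?g (unit_rot t) / unit_rot t) has_integral cpartial i f z) (cbox 0 1)"
    by (simp add: power2_eq_square)
  then show ?thesis by (simp add: integral_unique)
qed

lemma continuous_on_cpartial:
  assumes "sep_holomorphic f"
  shows "continuous_on UNIV (cpartial i f)"
proof -
  have f: "continuous_on UNIV f" using assms by (simp add: sep_holomorphic_def)
  have "continuous_on (UNIV \<times> cbox 0 1) (\<lambda>(z, t). f (z + axis i (unit_rot t)) / unit_rot t)"
    unfolding split_def
    by (intro continuous_intros continuous_on_compose2[OF f]) auto
  from integral_continuous_on_param[OF this] show ?thesis
    using cpartial_eq_integral[OF assms] by (metis (no_types, lifting) continuous_on_cong)
qed

text \<open>
  Differentiating the Cauchy integral shows at once that \<open>cpartial j f\<close> is holomorphic in each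
  variable and, since the value is the Cauchy integral of \<open>cpartial i f\<close>, that partial
  derivatives commute.
\<close>

lemma has_field_derivative_cpartial_commute:
  assumes "sep_holomorphic f"
  shows "((\<lambda>w. cpartial j f (z + axis i w)) has_field_derivative
           integral (cbox 0 1) (\<lambda>t. cpartial i f (z + axis i w + axis j (unit_rot t)) / unit_rot t)) (at w)"
proof -
  have f: "continuous_on UNIV f" using assms by (simp add: sep_holomorphic_def)
  \<comment> \<open>With the increment in direction \<open>i\<close> moved last, the derivative
    along a slice applies at the base point \<open>z + axis j v\<close>.\<close>
  have swap: "z + axis i w + axis j v = z + axis j v + axis i w" for w v :: complex
    by (simp add: algebra_simps)
  have "((\<lambda>w. integral (cbox 0 1) (\<lambda>t. f (z + axis i w + axis j (unit_rot t)) / unit_rot t))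
     has_field_derivative
      integral (cbox 0 1) (\<lambda>t. cpartial i f (z + axis i w + axis j (unit_rot t)) / unit_rot t)) (at w within UNIV)"
  proof (rule leibniz_rule_field_derivative)
    fix w t
    show "((\<lambda>w. f (z + axis i w + axis j (unit_rot t)) / unit_rot t) has_field_derivative
        cpartial i f (z + axis i w + axis j (unit_rot t)) / unit_rot t) (at w within UNIV)"
      unfolding swap by (intro DERIV_cdivide has_field_derivative_cpartial assms)
    show "(\<lambda>t. f (z + axis i w + axis j (unit_rot t)) / unit_rot t) integrable_on cbox 0 1"
      by (intro integrable_continuous continuous_intros continuous_on_compose2[OF f]) auto
  next
    show "continuous_on (UNIV \<times> cbox 0 1)
        (\<lambda>(w, t). cpartial i f (z + axis i w + axis j (unit_rot t)) / unit_rot t)"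
      unfolding split_def
      by (intro continuous_intros continuous_on_compose2[OF continuous_on_cpartial[OF assms]]) auto
  qed auto
  then show ?thesis by (simp add: cpartial_eq_integral[OF assms])
qed

lemma sep_holomorphic_cpartial:
  assumes "sep_holomorphic f"
  shows "sep_holomorphic (cpartial i f)"
  unfolding sep_holomorphic_def
proof (intro conjI allI)
  show "continuous_on UNIV (cpartial i f)" by (rule continuous_on_cpartial[OF assms])
  show "(\<lambda>w. cpartial i f (z + axis j w)) holomorphic_on UNIV" for j z
    unfolding holomorphic_on_open[OF open_UNIV]
    using has_field_derivative_cpartial_commute[OF assms] by blast
qed

lemma cpartial_commute:
  assumes "sep_holomorphic f"
  shows "cpartial i (cpartial j f) = cpartial j (cpartial i f)"
proof
  fix z
  have "cpartial i (cpartial j f) z =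
      integral (cbox 0 1) (\<lambda>t. cpartial i f (z + axis i 0 + axis j (unit_rot t)) / unit_rot t)"
    unfolding cpartial_def[of i "cpartial j f"]
    by (intro DERIV_imp_deriv has_field_derivative_cpartial_commute assms)
  also have "\<dots> = cpartial j (cpartial i f) z"
    by (simp add: cpartial_eq_integral[OF sep_holomorphic_cpartial[OF assms], of j] axis_def zero_vec_def[symmetric])
  finally show "cpartial i (cpartial j f) z = cpartial j (cpartial i f) z" .
qed

lemma sep_holomorphic_cpartials: "sep_holomorphic f \<Longrightarrow> sep_holomorphic (cpartials is f)"
  by (induction "is") (auto intro: sep_holomorphic_cpartial)

lemma cpartials_cpartial_commute:
  "sep_holomorphic f \<Longrightarrow> cpartials is (cpartial i f) = cpartial i (cpartials is f)"
  by (induction "is") (auto simp: cpartial_commute sep_holomorphic_cpartials)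

text \<open>Since partial derivatives commute, all those in direction \<open>i\<close> can be taken
  last. The one-variable estimate then handles them in a single step.\<close>

lemma cpartials_collect:
  assumes "sep_holomorphic f"
  shows "cpartials is f = cpartials (replicate (count_list is i) i) (cpartials (filter (\<lambda>j. j \<noteq> i) is) f)"
  using assms
  by (induction "is")
     (auto simp: cpartials_cpartial_commute[symmetric] sep_holomorphic_cpartials)

section \<open>Cauchy estimates on polydiscs\<close>

lemma higher_deriv_eq_cpartials_replicate:
  assumes "sep_holomorphic f"
  shows "(deriv ^^ k) (\<lambda>w. f (z + axis i w)) = (\<lambda>w. cpartials (replicate k i) f (z + axis i w))"
proof (induction k)
  case (Suc k)
  have "deriv (\<lambda>w. cpartials (replicate k i) f (z + axis i w)) w =
      cpartial i (cpartials (replicate k i) f) (z + axis i w)" for w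
    by (intro DERIV_imp_deriv has_field_derivative_cpartial sep_holomorphic_cpartials assms)
  with Suc show ?case by simp
qed simp

text \<open>The one-variable Cauchy inequality for the slice in direction \<open>i\<close>, whose
  iterated derivatives are the repeated partial derivatives.\<close>

lemma norm_cpartials_replicate_le:
  assumes "sep_holomorphic f" and "r > 0"
    and "\<And>w. norm w \<le> r \<Longrightarrow> norm (f (z + axis i w)) \<le> B"
  shows "norm (cpartials (replicate k i) f z) \<le> fact k * B / r ^ k"
proof -
  let ?g = "\<lambda>w. f (z + axis i w)"
  have hol: "?g holomorphic_on UNIV" using assms by (simp add: sep_holomorphic_def)
  have "norm ((deriv ^^ k) ?g 0) \<le> fact k * B / r ^ k"
    by (rule Cauchy_inequality)
       (auto intro: holomorphic_on_subset[OF hol] holomorphic_on_imp_continuous_on assms)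
  then show ?thesis by (simp add: higher_deriv_eq_cpartials_replicate[OF assms(1)])
qed

text \<open>Induction on the set \<open>S\<close> of directions in which the argument moves; each
  new direction costs one one-variable Cauchy estimate. The centre \<open>z\<close> must vary,
  because the induction hypothesis is used at displaced centres.\<close>

lemma norm_cpartials_le_on:
  assumes "finite S" and "sep_holomorphic f" and "\<And>i. R i > 0" and "set is \<subseteq> S"
    and "\<And>v. (\<And>i. norm (v $ i) \<le> R i) \<Longrightarrow> (\<And>i. i \<notin> S \<Longrightarrow> v $ i = 0) \<Longrightarrow> norm (f (z + v)) \<le> B"
  shows "norm (cpartials is f z) \<le> (\<Prod>i\<in>S. fact (count_list is i) / R i ^ count_list is i) * B"
  using assms(1,4,5)
proof (induction S arbitrary: "is" z rule: finite_induct)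
  case empty
  from empty.prems(2)[of 0] show ?case
    using empty.prems(1) assms(3) by (simp add: less_imp_le)
next
  case (insert a S)
  let ?js = "filter (\<lambda>j. j \<noteq> a) is" and ?k = "count_list is a"
  have js: "set ?js \<subseteq> S" using insert.prems(1) by auto
  have cnt: "count_list ?js i = count_list is i" if "i \<in> S" for i
    using that insert.hyps(2) by (induction "is") auto
  define P where "P = (\<Prod>i\<in>S. fact (count_list is i) / R i ^ count_list is i)"
  \<comment> \<open>A bound uniform on the disc in direction \<open>a\<close>: the remaining
    derivatives are estimated at the centre \<open>z + axis a w\<close>.\<close>
  have "norm (cpartials ?js f (z + axis a w)) \<le> P * B" if w: "norm w \<le> R a" for w
  proof -
    have "norm (cpartials ?js f (z + axis a w)) \<le>
        (\<Prod>i\<in>S. fact (count_list ?js i) / R i ^ count_list ?js i) * B"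
    proof (rule insert.IH[OF js])
      fix v :: "complex ^ 'a"
      assume v: "\<And>i. norm (v $ i) \<le> R i" "\<And>i. i \<notin> S \<Longrightarrow> v $ i = 0"
      \<comment> \<open>As \<open>a\<close> is not in \<open>S\<close>, \<open>v\<close> vanishes at
        \<open>a\<close>, so the combined displacement has coordinate \<open>w\<close> there and
        stays in the polydisc.\<close>
      have "norm (f (z + (axis a w + v))) \<le> B"
      proof (rule insert.prems(2))
        show "norm ((axis a w + v) $ i) \<le> R i" for i
          using v w insert.hyps(2) by (cases "i = a") (auto simp: axis_def)
        show "(axis a w + v) $ i = 0" if "i \<notin> insert a S" for i
          using v(2)[of i] that by (auto simp: axis_def)
      qed
      then show "norm (f (z + axis a w + v)) \<le> B" by (simp add: add.assoc)
    qed
    then show ?thesis by (simp add: P_def cnt cong: prod.cong)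
  qed
  then have "norm (cpartials (replicate ?k a) (cpartials ?js f) z) \<le> fact ?k * (P * B) / R a ^ ?k"
    by (intro norm_cpartials_replicate_le sep_holomorphic_cpartials assms)
  then show ?case
    using insert.hyps by (simp add: P_def cpartials_collect[OF assms(2), of "is" a, symmetric] mult.assoc)
qed

lemma norm_cpartials_le:
  assumes "sep_holomorphic f" and "\<And>i. R i > 0"
    and "\<And>v. (\<And>i. norm (v $ i) \<le> R i) \<Longrightarrow> norm (f (z + v)) \<le> B"
  shows "norm (cpartials is f z) \<le> (\<Prod>i\<in>UNIV. fact (count_list is i) / R i ^ count_list is i) * B"
  by (rule norm_cpartials_le_on) (use assms in auto)

section \<open>Restriction to the real subspace\<close>

lemma real_restriction_has_vector_derivative:
  assumes "sep_holomorphic g"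
  shows "((\<lambda>t. real_restriction g (x + t *\<^sub>R axis i 1)) has_vector_derivative
           real_restriction (cpartial i g) x) (at 0)"
proof -
  let ?z = "\<chi> i. complex_of_real (x $ i)"
  have "((\<lambda>w. g (?z + axis i w)) has_field_derivative cpartial i g (?z + axis i (of_real 0))) (at (of_real 0))"
    by (rule has_field_derivative_cpartial[OF assms])
  then have "((\<lambda>t. g (?z + axis i (of_real t))) has_vector_derivative cpartial i g ?z) (at 0)"
    using has_vector_derivative_real_field[of "\<lambda>w. g (?z + axis i w)"] by fastforce
  moreover have "?z + axis i (of_real t) = (\<chi> j. complex_of_real ((x + t *\<^sub>R axis i 1) $ j))" for t
    by (simp add: vec_eq_iff axis_def)
  ultimately show ?thesis by (simp add: real_restriction_def)
qed

text \<open>A real derivative along a real axis is the complex derivative of the slice evaluated at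
  real points, so differentiation commutes with restriction.\<close>

lemma partials_real_restriction:
  assumes "sep_holomorphic g"
  shows "partials is (real_restriction g) = real_restriction (cpartials is g)"
proof (induction "is")
  case (Cons i "is")
  have "partial i (real_restriction (cpartials is g)) x = real_restriction (cpartial i (cpartials is g)) x" for x
    unfolding partial_def
    by (intro vector_derivative_at real_restriction_has_vector_derivative sep_holomorphic_cpartials assms)
  with Cons show ?case by (auto simp: partials_def)
qed (simp add: partials_def)

lemma smooth_real_restriction:
  assumes "sep_holomorphic g"
  shows "smooth (real_restriction g)"
  unfolding smooth_def partials_real_restriction[OF assms]
proof (intro allI conjI)
  fix "is" i x
  have hol: "sep_holomorphic (cpartials is g)" by (rule sep_holomorphic_cpartials[OF assms])
  then have "continuous_on UNIV (cpartials is g)" by (simp add: sep_holomorphic_def)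
  then show "continuous_on UNIV (real_restriction (cpartials is g))"
    unfolding real_restriction_def
    by (rule continuous_on_compose2) (auto intro!: continuous_intros)
  show "has_partial_at i (real_restriction (cpartials is g)) x"
    unfolding has_partial_at_def
    using real_restriction_has_vector_derivative[OF hol] by (rule differentiableI_vector)
qed

lemma multi_deriv_real_restriction:
  fixes \<alpha> :: "nat ^ 'n"
  assumes "sep_holomorphic g"
  obtains "is" where "\<And>i. count_list is i = \<alpha> $ i"
    and "multi_deriv \<alpha> (real_restriction g) = real_restriction (cpartials is g)"
proof -
  \<comment> \<open>Some list with the prescribed multiplicities must exist before anything is known
    about the list that \<open>SOME\<close> selects in \<open>multi_deriv\<close>.\<close>
  obtain js where js: "mset js = (\<Sum>i\<in>UNIV. replicate_mset (\<alpha> $ i) i)" using ex_mset by blast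
  have "count_list js i = \<alpha> $ i" for i
  proof -
    have "count_list js i = count (mset js) i" by (simp add: count_mset)
    also have "\<dots> = (\<Sum>j\<in>UNIV. if j = i then \<alpha> $ j else 0)"
      by (simp add: js count_sum)
    finally show ?thesis by simp
  qed
  then have "\<exists>is. \<forall>i. count_list is i = \<alpha> $ i" by blast
  from someI_ex[OF this] show ?thesis
    by (intro that) (auto simp: multi_deriv_def partials_real_restriction[OF assms])
qed

section \<open>Weights\<close>

text \<open>The coordinates of \<open>x\<close> are replaced by those of \<open>y\<close> one at a
  time; the intermediate points stay in the nonnegative orthant.\<close>

lemma class_A_mono:
  assumes g: "g \<in> class_A" and x: "\<And>i. 0 \<le> x $ i" and xy: "\<And>i. x $ i \<le> y $ i"
  shows "g x \<le> g y"
proof -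
  have mono: "g x \<le> g (\<chi> j. if j = i then t else x $ j)"
    if "\<And>j. 0 \<le> x $ j" "x $ i \<le> t" for x i t
    using g that unfolding class_A_def by blast
  have "g x \<le> g (\<chi> j. if j \<in> S then y $ j else x $ j)" if "finite S" for S
    using that
  proof (induction S)
    case (insert a S)
    let ?u = "\<chi> j. if j \<in> S then y $ j else x $ j"
    have "g ?u \<le> g (\<chi> j. if j = a then y $ a else ?u $ j)"
      using insert.hyps x xy order_trans[OF x xy] by (intro mono) auto
    also have "(\<chi> j. if j = a then y $ a else ?u $ j) = (\<chi> j. if j \<in> insert a S then y $ j else x $ j)"
      by (auto simp: vec_eq_iff)
    finally show ?case using insert.IH by simp
  qed simp
  from this[of UNIV] show ?thesis by simp
qed

lemma p_norm_bound:
  assumes "p_norm \<phi> k f < \<infinity>"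
  obtains M where "M \<ge> 0"
    and "\<And>z. norm (f z) * (1 + norm z) ^ k \<le> M * exp (\<phi> (\<chi> i. \<bar>Im (z $ i)\<bar>))"
proof -
  let ?q = "\<lambda>z. norm (f z) * (1 + norm z) ^ k / exp (\<phi> (\<chi> i. \<bar>Im (z $ i)\<bar>))"
  have le: "ereal (?q z) \<le> p_norm \<phi> k f" for z
    unfolding p_norm_def by (rule SUP_upper) simp
  \<comment> \<open>The quotient at 0 is a real lower bound, so the supremum is a real
    number.\<close>
  have "p_norm \<phi> k f \<noteq> -\<infinity>" using le[of 0] by auto
  then obtain M where M: "p_norm \<phi> k f = ereal M" using assms by (cases "p_norm \<phi> k f") auto
  have q: "?q z \<le> M" for z using le[of z] by (simp add: M)
  show ?thesis
  proof
    have "0 \<le> ?q 0" by simp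
    also have "\<dots> \<le> M" by (rule q)
    finally show "M \<ge> 0" .
    show "norm (f z) * (1 + norm z) ^ k \<le> M * exp (\<phi> (\<chi> i. \<bar>Im (z $ i)\<bar>))" for z
      using q[of z] by (simp add: pos_divide_le_eq)
  qed
qed

text \<open>For positive \<open>a\<close>, taking logarithms bounds \<langle>\<alpha>, y\<rangle> -
  \<psi>(y) by \<open>ln (K / a)\<close> for all \<open>y\<close>, hence also its supremum, the
  conjugate. Finiteness of the conjugate makes \<open>real_of_ereal\<close> faithful.\<close>

lemma le_exp_psi_star:
  fixes \<phi> :: "real ^ 'n \<Rightarrow> real"
  assumes "\<phi> \<in> class_A" and "a \<ge> 0" and "K > 0"
    and le: "\<And>y. a \<le> K * exp (exp_subst \<phi> y - multi_real \<alpha> \<bullet> y)"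
  shows "a \<le> K * exp (- real_of_ereal (psi_star \<phi> (multi_real \<alpha>)))"
proof (cases "a = 0")
  case False
  then have a: "a > 0" using assms by simp
  have "multi_real \<alpha> \<bullet> y - exp_subst \<phi> y \<le> ln (K / a)" for y
  proof -
    have "exp (multi_real \<alpha> \<bullet> y - exp_subst \<phi> y) \<le> K / a"
      using le[of y] a by (simp add: exp_diff field_simps)
    then show ?thesis using a assms(3) by (simp add: ln_ge_iff)
  qed
  then have "psi_star \<phi> (multi_real \<alpha>) \<le> ereal (ln (K / a))"
    unfolding psi_star_def young_fenchel_def by (intro SUP_least) simp
  then have "real_of_ereal (psi_star \<phi> (multi_real \<alpha>)) \<le> ln (K / a)"
    using psi_star_multi_finite[OF assms(1), of \<alpha>] by (cases "psi_star \<phi> (multi_real \<alpha>)") auto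
  then have "exp (real_of_ereal (psi_star \<phi> (multi_real \<alpha>))) \<le> K / a"
    using a assms(3) by (simp add: ln_ge_iff)
  then show ?thesis using a by (simp add: exp_minus field_simps)
qed (use assms in simp)

lemma exp_inner_multi_real:
  "exp (multi_real \<alpha> \<bullet> y) = (\<Prod>i\<in>UNIV. exp (y $ i) ^ (\<alpha> $ i))"
  by (simp add: inner_vec_def multi_real_def exp_sum exp_of_nat_mult)

section \<open>The weighted estimate for fixed radii, and the theorem\<close>

lemma multi_deriv_bound:
  fixes \<phi> \<phi>' :: "real ^ 'n \<Rightarrow> real" and f :: "complex ^ 'n \<Rightarrow> complex"
  assumes A: "\<phi> \<in> class_A"
    and C: "\<And>x. \<phi> x + real (Suc m) * ln (1 + norm x) \<le> \<phi>' x + C"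
    and hol: "sep_holomorphic f"
    and M0: "M \<ge> 0"
    and M: "\<And>z. norm (f z) * (1 + norm z) ^ m \<le> M * exp (\<phi> (\<chi> i. \<bar>Im (z $ i)\<bar>))"
  shows "(1 + norm x) ^ m * norm (multi_deriv \<alpha> (real_restriction f) x) / multi_fact \<alpha>
           \<le> M * exp C * exp (exp_subst \<phi>' y - multi_real \<alpha> \<bullet> y)"
proof -
  let ?z = "\<chi> i. complex_of_real (x $ i)"
  define R where "R = (\<chi> i. exp (y $ i))"
  \<comment> \<open>\<open>B\<close> will bound the modulus of \<open>f\<close> on the polydisc of
    radii \<open>R\<close> about the real point \<open>x\<close>; its denominator carries the decay
    in \<open>x\<close>.\<close>
  define B where "B = M * exp (\<phi>' R + C) / (1 + norm x) ^ m"
  have nz: "norm ?z = norm x" by (simp add: norm_vec_def)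
  have weight: "(1 + norm R) ^ m * exp (\<phi> R) \<le> exp (\<phi>' R + C)"
  proof -
    \<comment> \<open>The exponent is raised to \<open>Suc m\<close> because the weight condition is
      available for positive \<open>A\<close> only, and \<open>m\<close> may be 0.\<close>
    have "(1 + norm R) ^ m \<le> (1 + norm R) ^ Suc m" by (rule power_increasing) auto
    also have "\<dots> = exp (real (Suc m) * ln (1 + norm R))"
      by (subst exp_of_nat_mult) (simp add: add_pos_nonneg)
    finally have "(1 + norm R) ^ m * exp (\<phi> R) \<le> exp (real (Suc m) * ln (1 + norm R)) * exp (\<phi> R)"
      by (rule mult_right_mono) simp
    also have "\<dots> = exp (\<phi> R + real (Suc m) * ln (1 + norm R))" by (simp add: exp_add)
    also have "\<dots> \<le> exp (\<phi>' R + C)" using C[of R] by simp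
    finally show ?thesis .
  qed
  have bound: "norm (f (?z + v)) \<le> B" if v: "\<And>i. norm (v $ i) \<le> R $ i" for v
  proof -
    have "norm v \<le> norm R"
    proof (rule norm_le_componentwise_cart)
      show "norm (v $ i) \<le> norm (R $ i)" for i using v[of i] by simp
    qed
    have "norm x = norm (?z + v - v)" by (simp add: nz)
    also have "\<dots> \<le> norm (?z + v) + norm v" by (rule norm_triangle_ineq4)
    also have "\<dots> \<le> norm (?z + v) + norm R" using \<open>norm v \<le> norm R\<close> by simp
    finally have "1 + norm x \<le> 1 + norm (?z + v) + norm R" by simp
    \<comment> \<open>The two sides differ by the product of the two norms.\<close>
    also have "\<dots> \<le> (1 + norm (?z + v)) * (1 + norm R)" by (simp add: algebra_simps)
    finally have "(1 + norm x) ^ m \<le> ((1 + norm (?z + v)) * (1 + norm R)) ^ m"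
      by (intro power_mono) auto
    then have "norm (f (?z + v)) * (1 + norm x) ^ m \<le>
        norm (f (?z + v)) * ((1 + norm (?z + v)) * (1 + norm R)) ^ m"
      by (intro mult_left_mono) auto
    also have "\<dots> = (norm (f (?z + v)) * (1 + norm (?z + v)) ^ m) * (1 + norm R) ^ m"
      by (simp add: power_mult_distrib)
    also have "\<dots> \<le> (M * exp (\<phi> (\<chi> i. \<bar>Im ((?z + v) $ i)\<bar>))) * (1 + norm R) ^ m"
      by (intro mult_right_mono M) auto
    also have "\<dots> \<le> (M * exp (\<phi> R)) * (1 + norm R) ^ m"
    proof -
      \<comment> \<open>The centre is real, so the imaginary part of each coordinate comes from
        \<open>v\<close> and is at most the radius.\<close>
      have "\<phi> (\<chi> i. \<bar>Im ((?z + v) $ i)\<bar>) \<le> \<phi> R"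
        using order_trans[OF abs_Im_le_cmod v] by (intro class_A_mono[OF A]) auto
      then show ?thesis using M0 by (intro mult_right_mono mult_left_mono) auto
    qed
    also have "\<dots> \<le> M * exp (\<phi>' R + C)"
      using mult_left_mono[OF weight M0] by (simp add: mult_ac)
    finally show ?thesis by (simp add: B_def pos_le_divide_eq add_pos_nonneg)
  qed
  obtain "is" where cnt: "\<And>i. count_list is i = \<alpha> $ i"
    and D: "multi_deriv \<alpha> (real_restriction f) = real_restriction (cpartials is f)"
    using multi_deriv_real_restriction[OF hol, of \<alpha>] by blast
  have "norm (cpartials is f ?z) \<le> (\<Prod>i\<in>UNIV. fact (count_list is i) / (R $ i) ^ count_list is i) * B"
    by (rule norm_cpartials_le[OF hol]) (use bound in \<open>auto simp: R_def\<close>)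
  \<comment> \<open>Radii \<open>exp (y $ i)\<close> make the product of the powers equal to
    \<open>exp (multi_real \<alpha> \<bullet> y)\<close>.\<close>
  also have "(\<Prod>i\<in>UNIV. fact (count_list is i) / (R $ i) ^ count_list is i) =
      multi_fact \<alpha> / exp (multi_real \<alpha> \<bullet> y)"
    by (simp add: cnt prod_dividef multi_fact_def exp_inner_multi_real R_def)
  finally have D_le: "norm (multi_deriv \<alpha> (real_restriction f) x) \<le>
      multi_fact \<alpha> / exp (multi_real \<alpha> \<bullet> y) * B"
    by (simp add: D real_restriction_def)
  have mf: "multi_fact \<alpha> > 0" unfolding multi_fact_def by (rule prod_pos) simp
  have "(1 + norm x) ^ m * norm (multi_deriv \<alpha> (real_restriction f) x) / multi_fact \<alpha> \<le>
      (1 + norm x) ^ m * (multi_fact \<alpha> / exp (multi_real \<alpha> \<bullet> y) * B) / multi_fact \<alpha>"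
    using mf D_le by (intro divide_right_mono mult_left_mono) auto
  also have "\<dots> = M * exp (\<phi>' R + C) / exp (multi_real \<alpha> \<bullet> y)"
  proof -
    have "(1 + norm x) ^ m \<noteq> 0" by (metis add_pos_nonneg less_irrefl norm_ge_zero power_not_zero zero_less_one)
    then show ?thesis using mf by (simp add: B_def)
  qed
  also have "\<dots> = M * exp C * exp (exp_subst \<phi>' y - multi_real \<alpha> \<bullet> y)"
    by (simp add: exp_subst_def R_def exp_add exp_diff)
  finally show ?thesis .
qed

theorem theorem1:
  fixes \<phi> :: "nat \<Rightarrow> real ^ 'n \<Rightarrow> real" and f :: "complex ^ 'n \<Rightarrow> complex"
  assumes "\<forall>m\<ge>1. \<phi> m \<in> class_A"
    and "\<forall>m\<ge>1. \<forall>A>0. \<exists>C>0. \<forall>x. \<phi> m x + A * ln (1 + norm x) \<le> \<phi> (m + 1) x + C"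
    and "f \<in> E_space \<phi>"
  shows "real_restriction f \<in> smooth_space (\<lambda>\<nu>. psi_star (\<phi> \<nu>))"
proof -
  obtain \<nu> where \<nu>: "\<nu> \<ge> 1" and f: "\<And>k. entire f \<and> p_norm (\<phi> \<nu>) k f < \<infinity>"
    using assms(3) by (auto simp: E_space_def E_weight_def E_level_def)
  have hol: "sep_holomorphic f" using f entire_imp_sep_holomorphic by blast
  \<comment> \<open>A single index serves every \<open>m\<close>: only the constant \<open>C\<close>
    depends on \<open>m\<close>.\<close>
  let ?h = "psi_star (\<phi> (\<nu> + 1))"
  have "smooth_norm ?h m (real_restriction f) < \<infinity>" for m
  proof -
    obtain C where C: "\<And>x. \<phi> \<nu> x + real (Suc m) * ln (1 + norm x) \<le> \<phi> (\<nu> + 1) x + C"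
      using assms(2) \<nu> by (metis of_nat_0_less_iff zero_less_Suc)
    obtain M where M0: "M \<ge> 0"
      and M: "\<And>z. norm (f z) * (1 + norm z) ^ m \<le> M * exp (\<phi> \<nu> (\<chi> i. \<bar>Im (z $ i)\<bar>))"
      using p_norm_bound f by blast
    \<comment> \<open>\<open>M\<close> may be 0, while the passage to the conjugate divides by
      \<open>a\<close> and takes \<open>ln (K / a)\<close>, which calls for a positive
      \<open>K\<close>.\<close>
    define K where "K = (M + 1) * exp C"
    have "K > 0" using M0 by (simp add: K_def)
    have "(1 + norm x) ^ m * norm (multi_deriv \<alpha> (real_restriction f) x) /
        (multi_fact \<alpha> * exp (- real_of_ereal (?h (multi_real \<alpha>)))) \<le> K" for x \<alpha>
    proof -
      let ?a = "(1 + norm x) ^ m * norm (multi_deriv \<alpha> (real_restriction f) x) / multi_fact \<alpha>"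
      have "multi_fact \<alpha> > 0" unfolding multi_fact_def by (rule prod_pos) simp
      then have "?a \<ge> 0" by simp
      have "?a \<le> K * exp (exp_subst (\<phi> (\<nu> + 1)) y - multi_real \<alpha> \<bullet> y)" for y
      proof -
        have "?a \<le> M * exp C * exp (exp_subst (\<phi> (\<nu> + 1)) y - multi_real \<alpha> \<bullet> y)"
          using assms(1) \<nu> by (intro multi_deriv_bound[OF _ C hol M0 M]) auto
        also have "\<dots> \<le> K * exp (exp_subst (\<phi> (\<nu> + 1)) y - multi_real \<alpha> \<bullet> y)"
          unfolding K_def by (intro mult_right_mono) auto
        finally show ?thesis .
      qed
      \<comment> \<open>The left side does not depend on \<open>y\<close>, so the best choice of
        radii may be taken, which yields the conjugate.\<close>
      then have "?a \<le> K * exp (- real_of_ereal (?h (multi_real \<alpha>)))"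
        using assms(1) \<open>?a \<ge> 0\<close> \<open>K > 0\<close> by (intro le_exp_psi_star) auto
      then have "?a / exp (- real_of_ereal (?h (multi_real \<alpha>))) \<le> K"
        by (subst pos_divide_le_eq) (rule exp_gt_zero)
      then show ?thesis by (simp only: divide_divide_eq_left)
    qed
    then have "smooth_norm ?h m (real_restriction f) \<le> ereal K"
      unfolding smooth_norm_def by (intro SUP_least) auto
    then show ?thesis by (rule le_less_trans) simp
  qed
  then have "real_restriction f \<in> smooth_weight ?h"
    using smooth_real_restriction[OF hol] by (auto simp: smooth_weight_def smooth_level_def)
  then show ?thesis unfolding smooth_space_def by (intro UN_I[of "\<nu> + 1"]) simp_all
qed

end
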